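(* There exist $d_0$ and $c>0$ such that for every integer $d\ge d_0$ and every positive even integer $n$, a uniformly chosen proper $3$-coloring $f\colon\mathbb{T}_n^d\to\{0,1,2\}$ of the discrete torus $\mathbb{T}_n^d$ satisfies $$\mathbb{E}\Big(\min_{i\in\{0,1\}} \mathrm{CP}_{i,k}(f)\Big)\ge \exp(-cd)\quad\text{for all }k\in\{0,1,2\}.$$
   Context: $\mathbb{T}_n^d$ is the graph of the $d$-dimensional discrete torus of side length $n$: its vertex set is $(\mathbb{Z}/n\mathbb{Z})^d$ and two vertices are adjacent if they differ by one (i.e. by $\pm1$ modulo $n$) in exactly one coordinate and agree in all others. As $n$ is even the graph is bipartite; its two partite classes are denoted $V^0$ and $V^1$. A proper $3$-coloring of $\mathbb{T}_n^d$ is a function $f\colon \mathbb{T}_n^d\to\{0,1,2\}$ with $f(v)\ne f(w)$ whenever $v,w$ are adjacent. For such $f$, $\mathrm{CP}_{i,k}(f):=\frac{|\{v\in V^i: f(v)=k\}|}{|V^i|}$ is the proportion of color $k$ on $V^i$. *)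

theory Defs
  imports "HOL-Probability.Probability_Mass_Function" "HOL-Number_Theory.Cong"
begin

(* (Z/nZ)^d is represented by coordinate functions on {..<d} whose values are the
   canonical residues {..<n}; outside {..<d} they are undefined, so that each vertex
   has exactly one representative. *)
definition torus_verts :: "nat \<Rightarrow> nat \<Rightarrow> (nat \<Rightarrow> nat) set" where
  "torus_verts n d = {..<d} \<rightarrow>\<^sub>E {..<n}"

definition torus_adj :: "nat \<Rightarrow> nat \<Rightarrow> (nat \<Rightarrow> nat) \<Rightarrow> (nat \<Rightarrow> nat) \<Rightarrow> bool" where
  "torus_adj n d v w \<longleftrightarrow>
     v \<in> torus_verts n d \<and> w \<in> torus_verts n d \<and>
     (\<exists>i<d. ([int (v i) - int (w i) = 1] (mod int n) \<or> [int (v i) - int (w i) = -1] (mod int n))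
            \<and> (\<forall>j<d. j \<noteq> i \<longrightarrow> v j = w j))"

(* For even n the torus is connected and bipartite, so its partite classes are
   determined up to order: they are the vertices of even and of odd coordinate sum. *)
definition partite_class :: "nat \<Rightarrow> nat \<Rightarrow> nat \<Rightarrow> (nat \<Rightarrow> nat) set" where
  "partite_class n d i = {v \<in> torus_verts n d. (\<Sum>j<d. v j) mod 2 = i}"

definition proper_3_colorings :: "nat \<Rightarrow> nat \<Rightarrow> ((nat \<Rightarrow> nat) \<Rightarrow> nat) set" where
  "proper_3_colorings n d =
     {f \<in> torus_verts n d \<rightarrow>\<^sub>E {0, 1, 2}. \<forall>v w. torus_adj n d v w \<longrightarrow> f v \<noteq> f w}"

definition color_proportion ::
    "nat \<Rightarrow> nat \<Rightarrow> nat \<Rightarrow> nat \<Rightarrow> ((nat \<Rightarrow> nat) \<Rightarrow> nat) \<Rightarrow> real" where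
  "color_proportion n d i k f =
     real (card {v \<in> partite_class n d i. f v = k}) / real (card (partite_class n d i))"

lemma finite_torus_verts: "finite (torus_verts n d)"
  by (simp add: torus_verts_def finite_PiE)

lemma partite_class_Un: "partite_class n d 0 \<union> partite_class n d 1 = torus_verts n d"
  by (auto simp: partite_class_def)

lemma torus_adj_parity:
  assumes "even n" "torus_adj n d v w"
  shows "(\<Sum>j<d. v j) mod 2 \<noteq> (\<Sum>j<d. w j) mod 2"
proof -
  obtain i where i: "i < d"
    and c: "[int (v i) - int (w i) = 1] (mod int n) \<or> [int (v i) - int (w i) = -1] (mod int n)"
    and eq: "\<forall>j<d. j \<noteq> i \<longrightarrow> v j = w j"
    using assms(2) by (auto simp: torus_adj_def)
  have "[int (v i) - int (w i) = 1] (mod 2) \<or> [int (v i) - int (w i) = -1] (mod 2)"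
    using c assms(1) cong_dvd_modulus[of _ _ "int n" 2] by auto
  hence "odd (int (v i) - int (w i))"
    by (auto simp: cong_iff_dvd_diff)
  hence "even (v i) \<noteq> even (w i)" by simp
  moreover have "(\<Sum>j\<in>{..<d} - {i}. v j) = (\<Sum>j\<in>{..<d} - {i}. w j)"
    using eq by (intro sum.cong) auto
  moreover have "(\<Sum>j<d. u j) = u i + (\<Sum>j\<in>{..<d} - {i}. u j)" for u :: "nat \<Rightarrow> nat"
    using i by (intro sum.remove) auto
  ultimately have "even (\<Sum>j<d. v j) \<noteq> even (\<Sum>j<d. w j)"
    by (metis even_add)
  thus ?thesis by (metis even_iff_mod_2_eq_zero)
qed

lemma finite_proper_3_colorings: "finite (proper_3_colorings n d)"
  unfolding proper_3_colorings_def
  by (rule finite_subset[OF _ finite_PiE[OF finite_torus_verts, of n d "\<lambda>_. {0, 1, 2}"]]) auto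

lemma proper_3_colorings_nonempty:
  assumes "even n"
  shows "proper_3_colorings n d \<noteq> {}"
proof -
  have "restrict (\<lambda>v. (\<Sum>j<d. v j) mod 2) (torus_verts n d) \<in> proper_3_colorings n d"
    using torus_adj_parity[OF assms]
    by (auto simp: proper_3_colorings_def torus_adj_def)
  thus ?thesis by blast
qed

end

theory Submission
  imports Defs
begin

text \<open>
  If no color has density at least \<open>\<delta> \<approx> d\<^sup>-\<^sup>2\<close> in both partite classes, then one class is almost
  entirely colored by a single color \<open>k\<close>, and some other color \<open>a\<close> fills almost half of the
  opposite class. For most vertices \<open>v\<close> of the first class the whole ball of radius 2 around \<open>v\<close>
  then has color \<open>k\<close> on that class, so the neighbors of \<open>v\<close> can be recolored by the third color
  and \<open>v\<close> by \<open>a\<close>. This switching forgets only the \<open>2d + 1\<close> old colors at \<open>v\<close> and its neighbors, so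
  on average over all colorings \<open>a\<close> has density at least \<open>exp (- c d)\<close> in both classes. The
  symmetry between the colors turns this into a bound for each single color.
\<close>

section \<open>Colorings of bipartite graphs with equal classes and bounded degree\<close>

text \<open>Indexing the classes by \<open>bool\<close> makes \<open>\<not> i\<close> the class
  opposite to \<open>i\<close>. The degree is only bounded above, because the two directions of a
  coordinate of the torus lead to the same neighbor when the side length is 2. By
  \<open>class_large\<close> one neighborhood fills at most an eighth of a class.\<close>

locale balanced_bipartite_graph =
  fixes X :: "bool \<Rightarrow> 'v set" and nbrs :: "'v \<Rightarrow> 'v set" and M D :: nat
  assumes finite_class: "finite (X i)"
    and card_class: "card (X i) = M"
    and disjoint_classes: "X i \<inter> X (\<not> i) = {}"
    and nbrs_subset: "v \<in> X i \<Longrightarrow> nbrs v \<subseteq> X (\<not> i)"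
    and nbrs_sym: "w \<in> nbrs v \<Longrightarrow> v \<in> nbrs w"
    and card_nbrs: "v \<in> X i \<Longrightarrow> card (nbrs v) \<le> D"
    and degree_pos: "D > 0"
    and class_large: "8 * D \<le> M"
begin

definition verts :: "'v set" where
  "verts = (\<Union>i. X i)"

definition colorings :: "('v \<Rightarrow> nat) set" where
  "colorings = {f \<in> verts \<rightarrow>\<^sub>E {0, 1, 2}. \<forall>v w. w \<in> nbrs v \<longrightarrow> v \<in> verts \<longrightarrow> f v \<noteq> f w}"

definition density :: "bool \<Rightarrow> nat \<Rightarrow> ('v \<Rightarrow> nat) \<Rightarrow> real" where
  "density i k f = real (card {v \<in> X i. f v = k}) / real M"

definition min_density :: "nat \<Rightarrow> ('v \<Rightarrow> nat) \<Rightarrow> real" where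
  "min_density k f = min (density False k f) (density True k f)"

lemma M_pos: "M > 0"
  using degree_pos class_large by simp

lemma finite_verts: "finite verts"
  unfolding verts_def using finite_class by simp

lemma class_subset_verts: "X i \<subseteq> verts"
  by (auto simp: verts_def)

lemma finite_nbrs: "v \<in> X i \<Longrightarrow> finite (nbrs v)"
  using nbrs_subset finite_class finite_subset by metis

lemma finite_colorings: "finite colorings"
  unfolding colorings_def
  by (rule finite_subset[OF _ finite_PiE[OF finite_verts, of "\<lambda>_. {0, 1, 2}"]]) auto

lemma coloring_cases: "f \<in> colorings \<Longrightarrow> v \<in> verts \<Longrightarrow> f v \<in> {0, 1, 2}"
  unfolding colorings_def by (auto simp: PiE_def Pi_def)

lemma density_nonneg: "density i k f \<ge> 0"
  by (simp add: density_def)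

lemma density_le_one: "density i k f \<le> 1"
proof -
  have "card {v \<in> X i. f v = k} \<le> card (X i)"
    by (intro card_mono finite_class) auto
  then show ?thesis
    using M_pos by (simp add: density_def card_class)
qed

lemma min_density_nonneg: "min_density k f \<ge> 0"
  by (simp add: min_density_def density_nonneg)

lemma min_density_alt: "min_density k f = min (density i k f) (density (\<not> i) k f)"
  by (cases i) (auto simp: min_density_def)

lemma sum_density:
  assumes "f \<in> colorings"
  shows "(\<Sum>k\<in>{0, 1, 2}. density i k f) = 1"
proof -
  have "M = card (\<Union>k\<in>{0, 1, 2}. {v \<in> X i. f v = k})"
  proof -
    have "(\<Union>k\<in>{0, 1, 2}. {v \<in> X i. f v = k}) = X i"
      using coloring_cases[OF assms] class_subset_verts[of i] by blast
    then show ?thesis by (simp add: card_class)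
  qed
  also have "\<dots> = (\<Sum>k\<in>{0, 1, 2}. card {v \<in> X i. f v = k})"
    by (rule card_UN_disjoint) (auto simp: finite_class)
  finally have "real M = (\<Sum>k\<in>{0, 1, 2}. real (card {v \<in> X i. f v = k}))"
    by (metis of_nat_sum)
  then show ?thesis
    using M_pos unfolding density_def sum_divide_distrib[symmetric] by simp
qed

section \<open>Colorings in which no color is frequent in both classes\<close>

text \<open>Each of the three colors is rare in one of the two classes, so by pigeonhole two colors
  are rare in the same class and the third, \<open>k\<close>, dominates it. As
  \<open>1 - 2 * \<delta>\<close> is at least 3/4, \<open>k\<close> must be rare in the other class,
  where the two other colors share more than 7/8.\<close>

lemma dichotomy:
  assumes f: "f \<in> colorings" and small: "\<forall>k\<in>{0, 1, 2}. min_density k f < \<delta>" and "\<delta> \<le> 1/8"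
  shows "\<exists>i. \<exists>k\<in>{0, 1, 2}. \<exists>a\<in>{0, 1, 2}. a \<noteq> k \<and>
           density i k f > 1 - 2 * \<delta> \<and> density (\<not> i) a f > 7/16"
proof -
  let ?p = "\<lambda>k. density False k f" and ?q = "\<lambda>k. density True k f"
  have sums: "?p 0 + ?p 1 + ?p 2 = 1" "?q 0 + ?q 1 + ?q 2 = 1"
    using sum_density[OF f, of False] sum_density[OF f, of True] by (simp_all add: add_ac)
  have small': "?p k < \<delta> \<or> ?q k < \<delta>" if "k \<in> {0, 1, 2}" for k
    using small that by (auto simp: min_density_def min_less_iff_disj)
  have rare: "\<exists>a\<in>{0, 1, 2}. a \<noteq> k \<and> r a > 7/16"
    if "k \<in> {0, 1, 2}" "r k < \<delta>" "r 0 + r 1 + r 2 = 1" for k :: nat and r :: "nat \<Rightarrow> real"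
  proof (rule ccontr)
    assume "\<not> ?thesis"
    then have "\<forall>a\<in>{0, 1, 2}. a = k \<or> r a \<le> 7/16" by force
    with that \<open>\<delta> \<le> 1/8\<close> show False by auto
  qed
  consider k where "k \<in> {0, 1, 2}" "?p k > 1 - 2 * \<delta>" "?q k < \<delta>"
    | k where "k \<in> {0, 1, 2}" "?q k > 1 - 2 * \<delta>" "?p k < \<delta>"
  proof -
    have "\<exists>k\<in>{0, 1, 2}. ?p k > 1 - 2 * \<delta> \<and> ?q k < \<delta> \<or> ?q k > 1 - 2 * \<delta> \<and> ?p k < \<delta>"
    proof -
      have "?p 0 < \<delta> \<or> ?q 0 < \<delta>" "?p 1 < \<delta> \<or> ?q 1 < \<delta>" "?p 2 < \<delta> \<or> ?q 2 < \<delta>"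
        using small' by auto
      with sums \<open>\<delta> \<le> 1/8\<close>
      have "?p 0 > 1 - 2 * \<delta> \<and> ?q 0 < \<delta> \<or> ?q 0 > 1 - 2 * \<delta> \<and> ?p 0 < \<delta> \<or>
            ?p 1 > 1 - 2 * \<delta> \<and> ?q 1 < \<delta> \<or> ?q 1 > 1 - 2 * \<delta> \<and> ?p 1 < \<delta> \<or>
            ?p 2 > 1 - 2 * \<delta> \<and> ?q 2 < \<delta> \<or> ?q 2 > 1 - 2 * \<delta> \<and> ?p 2 < \<delta>"
        by (smt (verit))
      then show ?thesis by blast
    qed
    then show ?thesis using that by blast
  qed
  then show ?thesis
  proof cases
    case (1 k)
    with rare[of k ?q] sums(2) obtain a where "a \<in> {0, 1, 2}" "a \<noteq> k" "?q a > 7/16"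
      by blast
    with 1 show ?thesis by (intro exI[of _ False] bexI[of _ k] bexI[of _ a]) simp_all
  next
    case (2 k)
    with rare[of k ?p] sums(1) obtain a where "a \<in> {0, 1, 2}" "a \<noteq> k" "?p a > 7/16"
      by blast
    with 2 show ?thesis by (intro exI[of _ True] bexI[of _ k] bexI[of _ a]) simp_all
  qed
qed

section \<open>Monochromatic balls of radius 2 and switching\<close>

text \<open>This is the part of the ball of radius 2 around \<open>v\<close> that lies in the class
  of \<open>v\<close>; \<open>insert\<close> keeps \<open>v\<close> in it even when \<open>v\<close>
  has no neighbors.\<close>

definition second_nbrs :: "'v \<Rightarrow> 'v set" where
  "second_nbrs v = insert v (\<Union>u\<in>nbrs v. nbrs u)"

lemma second_nbrs_sym: "w \<in> second_nbrs v \<Longrightarrow> v \<in> second_nbrs w"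
  unfolding second_nbrs_def using nbrs_sym by blast

lemma second_nbrs_subset:
  assumes "v \<in> X i"
  shows "second_nbrs v \<subseteq> X i"
  using assms nbrs_subset[OF assms] nbrs_subset[of _ "\<not> i"] unfolding second_nbrs_def by auto

lemma card_second_nbrs:
  assumes "v \<in> X i"
  shows "card (second_nbrs v) \<le> 1 + D\<^sup>2"
proof -
  have "card (\<Union>u\<in>nbrs v. nbrs u) \<le> (\<Sum>u\<in>nbrs v. card (nbrs u))"
    by (rule card_UN_le[OF finite_nbrs[OF assms]])
  also have "\<dots> \<le> (\<Sum>u\<in>nbrs v. D)"
    using nbrs_subset[OF assms] card_nbrs[of _ "\<not> i"] by (intro sum_mono) auto
  also have "\<dots> \<le> D\<^sup>2"
    using card_nbrs[OF assms] by (simp add: power2_eq_square)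
  finally have "card (\<Union>u\<in>nbrs v. nbrs u) \<le> D\<^sup>2" .
  then show ?thesis
    unfolding second_nbrs_def using card_insert_le_m1[of "1 + D\<^sup>2"] by simp
qed

definition monochromatic :: "('v \<Rightarrow> nat) \<Rightarrow> 'v \<Rightarrow> bool" where
  "monochromatic f v \<longleftrightarrow> (\<forall>w\<in>second_nbrs v. f w = f v)"

text \<open>A vertex fails only if it lies in \<open>second_nbrs w\<close> for some \<open>w\<close>
  whose color is not \<open>k\<close>. There are at most \<open>2 * \<delta> * M\<close> such
  \<open>w\<close>, each spoiling at most \<open>1 + D\<^sup>2\<close> vertices, and
  \<open>\<delta>\<close> is chosen so that the product is \<open>M / 2\<close>.\<close>

lemma many_monochromatic:
  assumes k: "density i k f > 1 - 2 * \<delta>" and \<delta>: "\<delta> = 1 / (4 * (1 + real D ^ 2))"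
  shows "M \<le> 2 * card {v \<in> X i. f v = k \<and> monochromatic f v}"
proof -
  let ?good = "{v \<in> X i. f v = k \<and> monochromatic f v}"
  let ?off = "{w \<in> X i. f w \<noteq> k}"
  have "X i \<subseteq> ?good \<union> (\<Union>w\<in>?off. second_nbrs w)"
  proof
    fix v assume v: "v \<in> X i"
    show "v \<in> ?good \<union> (\<Union>w\<in>?off. second_nbrs w)"
    proof (cases "\<forall>w\<in>second_nbrs v. f w = k")
      case True
      then have "f v = k" by (simp add: second_nbrs_def)
      with True v show ?thesis by (simp add: monochromatic_def)
    next
      case False
      then obtain w where w: "w \<in> second_nbrs v" "f w \<noteq> k" by blast
      then have "w \<in> ?off" using second_nbrs_subset[OF v] by blast
      with second_nbrs_sym[OF w(1)] show ?thesis by blast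
    qed
  qed
  moreover have fin: "finite (?good \<union> (\<Union>w\<in>?off. second_nbrs w))"
    using finite_class second_nbrs_subset[of _ i] by (auto intro: finite_subset)
  ultimately have "card (X i) \<le> card (?good \<union> (\<Union>w\<in>?off. second_nbrs w))"
    by (intro card_mono)
  also have "\<dots> \<le> card ?good + card (\<Union>w\<in>?off. second_nbrs w)"
    by (rule card_Un_le)
  also have "card (\<Union>w\<in>?off. second_nbrs w) \<le> (\<Sum>w\<in>?off. card (second_nbrs w))"
    by (rule card_UN_le) (simp add: finite_class)
  also have "\<dots> \<le> (\<Sum>w\<in>?off. 1 + D\<^sup>2)"
    using card_second_nbrs[of _ i] by (intro sum_mono) blast
  finally have 1: "M \<le> card ?good + card ?off * (1 + D\<^sup>2)"
    by (simp add: card_class)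
  have "card ?off + card {w \<in> X i. f w = k} = card (?off \<union> {w \<in> X i. f w = k})"
    by (rule card_Un_disjoint[symmetric]) (auto simp: finite_class)
  also have "?off \<union> {w \<in> X i. f w = k} = X i" by blast
  finally have "real (card ?off) = real M - real M * density i k f"
    using M_pos by (simp add: density_def card_class flip: of_nat_add)
  also have "\<dots> \<le> real M - real M * (1 - 2 * \<delta>)"
    using k by (intro diff_left_mono mult_left_mono) auto
  finally have 2: "real (card ?off) \<le> 2 * \<delta> * real M" by (simp add: algebra_simps)
  have "real (card ?off) * (1 + real D ^ 2) \<le> 2 * \<delta> * real M * (1 + real D ^ 2)"
    by (rule mult_right_mono[OF 2]) simp
  also have "\<dots> = real M / 2"
  proof -
    have "2 * (1 / (4 * e)) * m * e = m / 2" if "e > 0" for e m :: real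
      using that by (simp add: field_simps)
    from this[of "1 + real D ^ 2"] show ?thesis
      unfolding \<delta> by (simp only: add_pos_nonneg zero_less_one zero_le_power2)
  qed
  finally have "real (card ?off * (1 + D\<^sup>2)) \<le> real M / 2"
    by (simp only: of_nat_mult of_nat_add of_nat_power of_nat_1)
  moreover have "real M \<le> real (card ?good) + real (card ?off * (1 + D\<^sup>2))"
    using of_nat_mono[OF 1, where 'a = real] by (simp only: of_nat_add)
  ultimately show ?thesis by linarith
qed

text \<open>
  As the colors sum to 3, \<open>3 - f v - a\<close> is the color different from both \<open>f v\<close> and \<open>a\<close>,
  provided that \<open>a \<noteq> f v\<close>.
\<close>

definition switch :: "nat \<Rightarrow> 'v \<Rightarrow> ('v \<Rightarrow> nat) \<Rightarrow> 'v \<Rightarrow> nat" where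
  "switch a v f = (\<lambda>w. if w = v then a else if w \<in> nbrs v then 3 - f v - a else f w)"

text \<open>The recolored neighbors of \<open>v\<close> are adjacent only to \<open>v\<close>, now
  of color \<open>a\<close>, and to other vertices of \<open>second_nbrs v\<close>, which keep the
  color \<open>f v\<close>. The third color avoids both.\<close>

lemma switch_in_colorings:
  assumes f: "f \<in> colorings" and v: "v \<in> X i" and mono: "monochromatic f v"
    and a: "a \<in> {0, 1, 2}" "a \<noteq> f v"
  shows "switch a v f \<in> colorings"
proof -
  define b where "b = 3 - f v - a"
  have fv: "f v \<in> {0, 1, 2}"
    using coloring_cases[OF f] v class_subset_verts[of i] by blast
  have b: "b \<in> {0, 1, 2}" "b \<noteq> a" "b \<noteq> f v"
    using fv a by (auto simp: b_def)
  have "v \<notin> nbrs v"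
    using nbrs_subset[OF v] v disjoint_classes[of i] by blast
  have nv: "nbrs v \<subseteq> verts" "v \<in> verts"
    using nbrs_subset[OF v] v class_subset_verts by blast+
  have far: "f y = f v" "y \<notin> nbrs v" if "x \<in> nbrs v" "y \<in> nbrs x" for x y
  proof -
    have y: "y \<in> second_nbrs v" using that by (auto simp: second_nbrs_def)
    then show "f y = f v" using mono by (simp add: monochromatic_def)
    show "y \<notin> nbrs v"
      using y second_nbrs_subset[OF v] nbrs_subset[OF v] disjoint_classes[of i] by blast
  qed
  have "switch a v f \<in> verts \<rightarrow>\<^sub>E {0, 1, 2}"
    using f a b nv unfolding colorings_def switch_def b_def[symmetric] by (auto simp: PiE_iff extensional_def)
  moreover have "switch a v f x \<noteq> switch a v f y" if y: "y \<in> nbrs x" and x: "x \<in> verts" for x y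
  proof -
    have "f x \<noteq> f y" using f x y by (simp add: colorings_def)
    moreover have "x \<in> nbrs y" by (rule nbrs_sym[OF y])
    ultimately show ?thesis
      using y far[of x y] far[of y x] b \<open>v \<notin> nbrs v\<close>
      unfolding switch_def b_def[symmetric] by (auto split: if_splits)
  qed
  ultimately show ?thesis by (simp add: colorings_def)
qed

text \<open>In the opposite class only the neighbors of \<open>v\<close> change color. They make up
  at most 1/8 of it, and 7/16 - 1/8 exceeds 1/4.\<close>

lemma density_switch:
  assumes v: "v \<in> X i" and a: "density (\<not> i) a f > 7/16"
  shows "density (\<not> i) a (switch a v f) \<ge> 1/4"
proof -
  let ?f = "{w \<in> X (\<not> i). f w = a}" and ?g = "{w \<in> X (\<not> i). switch a v f w = a}"
  have "?f \<subseteq> ?g \<union> nbrs v"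
    by (auto simp: switch_def)
  then have "card ?f \<le> card (?g \<union> nbrs v)"
    using finite_nbrs[OF v] by (intro card_mono) (auto simp: finite_class)
  also have "\<dots> \<le> card ?g + card (nbrs v)" by (rule card_Un_le)
  also have "\<dots> \<le> card ?g + D" using card_nbrs[OF v] by simp
  finally have "real (card ?f) \<le> real (card ?g) + real D"
    by (metis of_nat_add of_nat_le_iff)
  moreover have "real M * (7/16) < real (card ?f)"
    using a M_pos by (simp add: density_def field_simps)
  moreover have "8 * real D \<le> real M"
    using class_large by (metis of_nat_le_iff of_nat_mult of_nat_numeral)
  ultimately have "real M / 4 \<le> real (card ?g)" by linarith
  then show ?thesis
    using M_pos by (simp add: density_def field_simps)
qed

section \<open>Double counting of switchings\<close>

text \<open>A vertex at which a switching has just been made is of this kind, so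
  \<open>rich g\<close> bounds the possible places of a switching that produced
  \<open>g\<close>.\<close>

definition rich :: "('v \<Rightarrow> nat) \<Rightarrow> 'v set" where
  "rich g = {v. \<exists>i. v \<in> X i \<and> density (\<not> i) (g v) g \<ge> 1/4}"

text \<open>A color contributes vertices of class \<open>i\<close> only if its density in the
  opposite class is at least 1/4. Its density in class \<open>i\<close> is then at most 4 times its
  minimum density, and the two classes together give the factor 8.\<close>

lemma card_rich:
  assumes g: "g \<in> colorings"
  shows "real (card (rich g)) \<le> 8 * real M * (\<Sum>k\<in>{0, 1, 2}. min_density k g)"
proof -
  define R where "R i k = (if density (\<not> i) k g \<ge> 1/4 then {v \<in> X i. g v = k} else {})" for i k
  have "rich g \<subseteq> (\<Union>i. \<Union>k\<in>{0, 1, 2}. R i k)"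
    using coloring_cases[OF g] class_subset_verts by (fastforce simp: rich_def R_def)
  then have "card (rich g) \<le> card (\<Union>i. \<Union>k\<in>{0, 1, 2}. R i k)"
    by (rule card_mono[rotated]) (auto simp: R_def finite_class)
  also have "\<dots> \<le> (\<Sum>i\<in>UNIV. card (\<Union>k\<in>{0, 1, 2}. R i k))"
    by (rule card_UN_le) simp
  also have "\<dots> \<le> (\<Sum>i\<in>UNIV. \<Sum>k\<in>{0, 1, 2}. card (R i k))"
    by (intro sum_mono card_UN_le) simp
  finally have "real (card (rich g)) \<le> (\<Sum>i\<in>UNIV. \<Sum>k\<in>{0, 1, 2}. real (card (R i k)))"
    by (metis (mono_tags, lifting) of_nat_le_iff of_nat_sum sum.cong)
  also have "\<dots> \<le> (\<Sum>i\<in>(UNIV::bool set). \<Sum>k\<in>{0, 1, 2}. 4 * real M * min_density k g)"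
  proof (intro sum_mono)
    fix i k
    show "real (card (R i k)) \<le> 4 * real M * min_density k g"
    proof (cases "density (\<not> i) k g \<ge> 1/4")
      case True
      \<comment> \<open>If the minimum is attained in the opposite class, it is at least 1/4, while
        the density in class \<open>i\<close> is at most 1.\<close>
      have "density i k g \<le> 4 * min_density k g"
        using True density_le_one[of i k g] density_nonneg[of i k g]
        by (auto simp: min_density_alt[of _ _ i] min_def)
      then have "real M * density i k g \<le> real M * (4 * min_density k g)"
        by (rule mult_left_mono) simp
      with True show ?thesis
        using M_pos by (simp add: R_def density_def)
    qed (simp add: R_def min_density_nonneg)
  qed
  also have "\<dots> = 8 * real M * (\<Sum>k\<in>{0, 1, 2}. min_density k g)"
    by (simp add: sum_distrib_left UNIV_bool algebra_simps)
  finally show ?thesis .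
qed

text \<open>The first constant is \<open>1 / \<delta>\<close> and pays for the colorings in which
  some color has minimum density at least \<open>\<delta>\<close>. The others are counted through
  switchings: \<open>3 ^ (D + 1)\<close> bounds the possible forgotten colors, and 16 is the factor
  2 of \<open>many_monochromatic\<close> times the factor 8 of \<open>card_rich\<close>.\<close>

lemma sum_min_density_ge:
  "real (card colorings) \<le>
     (4 * (1 + real D ^ 2) + 16 * 3 ^ (D + 1)) * (\<Sum>f\<in>colorings. \<Sum>k\<in>{0, 1, 2}. min_density k f)"
proof -
  define \<delta> :: real where "\<delta> = 1 / (4 * (1 + real D ^ 2))"
  define G where "G f = (\<Sum>k\<in>{0, 1, 2}. min_density k f)" for f
  define B where "B = {f \<in> colorings. \<forall>k\<in>{0, 1, 2}. min_density k f < \<delta>}"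
  have G_nonneg: "G f \<ge> 0" for f
    unfolding G_def by (intro sum_nonneg min_density_nonneg)
  have "B \<subseteq> colorings" by (auto simp: B_def)
  have finite_B: "finite B" using \<open>B \<subseteq> colorings\<close> finite_colorings finite_subset by blast
  have "\<delta> > 0" by (simp add: \<delta>_def add_pos_nonneg)
  have "real D ^ 2 \<ge> 1" using degree_pos by simp
  then have \<delta>_le: "\<delta> \<le> 1/8"
    by (simp add: \<delta>_def divide_simps)

  have "real (card (colorings - B)) * \<delta> = (\<Sum>f\<in>colorings - B. \<delta>)" by simp
  also have "\<dots> \<le> (\<Sum>f\<in>colorings - B. G f)"
  proof (rule sum_mono)
    fix f assume "f \<in> colorings - B"
    then obtain k where k: "k \<in> {0, 1, 2}" "\<delta> \<le> min_density k f"
      unfolding B_def by force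
    note k(2)
    also have "min_density k f \<le> G f"
      unfolding G_def by (rule member_le_sum[OF k(1)]) (auto simp: min_density_nonneg)
    finally show "\<delta> \<le> G f" .
  qed
  also have "\<dots> \<le> (\<Sum>f\<in>colorings. G f)"
    by (rule sum_mono2) (auto simp: finite_colorings G_nonneg)
  finally have outside: "real (card (colorings - B)) \<le> 4 * (1 + real D ^ 2) * (\<Sum>f\<in>colorings. G f)"
    using \<open>\<delta> > 0\<close> by (simp add: \<delta>_def field_simps)

  define P where "P f i k a \<longleftrightarrow> a \<in> {0, 1, 2} \<and> a \<noteq> k \<and>
      density i k f > 1 - 2 * \<delta> \<and> density (\<not> i) a f > 7/16" for f i and k a :: nat
  have "\<exists>i k a. P f i k a" if "f \<in> B" for f
    using dichotomy[of f \<delta>] that \<delta>_le unfolding B_def P_def by blast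
  then obtain I K A where "P f (I f) (K f) (A f)" if "f \<in> B" for f
    by metis
  then have IKA: "A f \<in> {0, 1, 2} \<and> A f \<noteq> K f \<and>
      density (I f) (K f) f > 1 - 2 * \<delta> \<and> density (\<not> I f) (A f) f > 7/16" if "f \<in> B" for f
    using that unfolding P_def by blast
  \<comment> \<open>\<open>S\<close> lists the possible switchings. \<open>\<phi>\<close> performs
    them, keeping the place and the overwritten colors, and \<open>T\<close> contains all
    outcomes.\<close>
  define S where "S = (SIGMA f:B. {v \<in> X (I f). f v = K f \<and> monochromatic f v})"
  define \<phi> where "\<phi> = (\<lambda>(f, v). (switch (A f) v f, v, restrict f (insert v (nbrs v))))"
  define T where "T = (SIGMA g:colorings. SIGMA v:rich g. insert v (nbrs v) \<rightarrow>\<^sub>E {0, 1, 2 :: nat})"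
  have finite_rich: "finite (rich g)" for g
    by (rule finite_subset[OF _ finite_verts]) (auto simp: rich_def verts_def)
  have fiber: "finite (insert v (nbrs v) \<rightarrow>\<^sub>E {0, 1, 2 :: nat})"
    "card (insert v (nbrs v) \<rightarrow>\<^sub>E {0, 1, 2 :: nat}) \<le> 3 ^ (D + 1)" if "v \<in> rich g" for v g
  proof -
    obtain i where i: "v \<in> X i" using \<open>v \<in> rich g\<close> by (auto simp: rich_def)
    show "finite (insert v (nbrs v) \<rightarrow>\<^sub>E {0, 1, 2 :: nat})"
      using finite_nbrs[OF i] by (intro finite_PiE) auto
    have "card (insert v (nbrs v)) \<le> D + 1"
      using card_nbrs[OF i] finite_nbrs[OF i] by (simp add: card_insert_if)
    then show "card (insert v (nbrs v) \<rightarrow>\<^sub>E {0, 1, 2 :: nat}) \<le> 3 ^ (D + 1)"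
      using finite_nbrs[OF i] by (simp add: card_PiE numeral_eq_Suc del: power_Suc)
  qed
  \<comment> \<open>Off \<open>insert v (nbrs v)\<close> the switched coloring still equals
    \<open>f\<close>, and on this set the third component records \<open>f\<close>; so
    \<open>f\<close> is recovered without knowing \<open>A f\<close>.\<close>
  have "inj_on \<phi> S"
  proof (rule inj_onI)
    fix p q assume "\<phi> p = \<phi> q"
    then obtain f g v where pq: "p = (f, v)" "q = (g, v)"
      and s: "switch (A f) v f = switch (A g) v g"
      and r: "restrict f (insert v (nbrs v)) = restrict g (insert v (nbrs v))"
      by (cases p; cases q) (auto simp: \<phi>_def)
    have "f w = g w" for w
      using fun_cong[OF s, of w] fun_cong[OF r, of w]
      by (cases "w \<in> insert v (nbrs v)") (auto simp: switch_def)
    with pq show "p = q" by auto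
  qed
  moreover have "\<phi> ` S \<subseteq> T"
  proof
    fix t assume "t \<in> \<phi> ` S"
    then obtain f v where t: "t = \<phi> (f, v)" and f: "f \<in> B" and v: "v \<in> X (I f)"
      and fv: "f v = K f" and mono: "monochromatic f v"
      by (auto simp: S_def)
    let ?g = "switch (A f) v f"
    have "?g \<in> colorings"
      using f v fv mono IKA[OF f] \<open>B \<subseteq> colorings\<close> by (intro switch_in_colorings) auto
    moreover have "v \<in> rich ?g"
      using density_switch[OF v, of "A f" f] IKA[OF f] v by (auto simp: rich_def switch_def)
    moreover have "restrict f (insert v (nbrs v)) \<in> insert v (nbrs v) \<rightarrow>\<^sub>E {0, 1, 2}"
    proof (rule restrict_PiE_iff[THEN iffD2], rule ballI)
      fix w assume "w \<in> insert v (nbrs v)"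
      then have "w \<in> verts" using v nbrs_subset[OF v] class_subset_verts by blast
      then show "f w \<in> {0, 1, 2}" using coloring_cases f \<open>B \<subseteq> colorings\<close> by blast
    qed
    ultimately show "t \<in> T" by (simp add: t \<phi>_def T_def)
  qed
  moreover have "finite T"
    unfolding T_def using fiber(1) by (intro finite_SigmaI finite_colorings finite_rich)
  ultimately have "card S \<le> card T" by (rule card_inj_on_le)

  \<comment> \<open>Each coloring in \<open>B\<close> admits a switching at no fewer than half of
    the vertices of class \<open>I f\<close>.\<close>
  have "M * card B = (\<Sum>f\<in>B. M)" by simp
  also have "\<dots> \<le> (\<Sum>f\<in>B. 2 * card {v \<in> X (I f). f v = K f \<and> monochromatic f v})"
    using IKA by (intro sum_mono many_monochromatic[OF _ \<delta>_def]) blast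
  also have "\<dots> = 2 * card S"
    unfolding S_def using finite_B by (simp add: card_SigmaI finite_class sum_distrib_left)
  also have "\<dots> \<le> 2 * card T" using \<open>card S \<le> card T\<close> by simp
  also have "card T = (\<Sum>g\<in>colorings. \<Sum>v\<in>rich g. card (insert v (nbrs v) \<rightarrow>\<^sub>E {0, 1, 2 :: nat}))"
    unfolding T_def using fiber(1)
    by (subst card_SigmaI) (auto simp: finite_colorings finite_rich intro!: sum.cong card_SigmaI finite_SigmaI)
  also have "\<dots> \<le> (\<Sum>g\<in>colorings. \<Sum>v\<in>rich g. 3 ^ (D + 1))"
    by (intro sum_mono fiber(2))
  also have "\<dots> = 3 ^ (D + 1) * (\<Sum>g\<in>colorings. card (rich g))"
    by (simp add: sum_distrib_left mult_ac)
  finally have "M * card B \<le> 2 * (3 ^ (D + 1) * (\<Sum>g\<in>colorings. card (rich g)))" by simp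
  then have "real (M * card B) \<le> real (2 * (3 ^ (D + 1) * (\<Sum>g\<in>colorings. card (rich g))))"
    by (rule of_nat_mono)
  then have "real M * real (card B) \<le> 2 * 3 ^ (D + 1) * (\<Sum>g\<in>colorings. real (card (rich g)))"
    by (simp only: of_nat_mult of_nat_sum of_nat_power of_nat_numeral mult.assoc)
  also have "\<dots> \<le> 2 * 3 ^ (D + 1) * (\<Sum>g\<in>colorings. 8 * real M * G g)"
    using card_rich unfolding G_def by (intro mult_left_mono sum_mono) auto
  also have "\<dots> = real M * (16 * 3 ^ (D + 1) * (\<Sum>g\<in>colorings. G g))"
    by (simp add: sum_distrib_left[symmetric])
  finally have inside: "real (card B) \<le> 16 * 3 ^ (D + 1) * (\<Sum>g\<in>colorings. G g)"
    using M_pos by simp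

  have "real (card colorings) = real (card (colorings - B)) + real (card B)"
    using \<open>B \<subseteq> colorings\<close> finite_colorings finite_B
    by (simp add: card_Diff_subset card_mono of_nat_diff)
  with outside inside show ?thesis
    unfolding G_def by (simp add: distrib_right)
qed

section \<open>Symmetry between the colors\<close>

text \<open>Exchanging the colors \<open>j\<close> and \<open>k\<close> is an involution on the
  colorings that carries one summand to the other.\<close>

lemma sum_min_density_eq:
  assumes "j \<in> {0, 1, 2}" "k \<in> {0, 1, 2}"
  shows "(\<Sum>f\<in>colorings. min_density j f) = (\<Sum>f\<in>colorings. min_density k f)"
proof -
  let ?\<tau> = "Transposition.transpose j k"
  \<comment> \<open>Off \<open>verts\<close> the value is \<open>undefined\<close>, an unspecified
    number that \<open>?\<tau>\<close> might move; \<open>restrict\<close> resets it.\<close>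
  let ?h = "\<lambda>f. restrict (?\<tau> \<circ> f) verts"
  have \<tau>: "?\<tau> c \<in> {0, 1, 2}" if "c \<in> {0, 1, 2}" for c
    using that assms by (auto simp: Transposition.transpose_def)
  have h: "?h f \<in> colorings" if f: "f \<in> colorings" for f
  proof -
    have "?h f \<in> verts \<rightarrow>\<^sub>E {0, 1, 2}"
      by (intro restrict_PiE_iff[THEN iffD2] ballI) (simp only: o_apply \<tau> coloring_cases[OF f])
    moreover have "?h f v \<noteq> ?h f w" if "w \<in> nbrs v" "v \<in> verts" for v w
    proof -
      have "w \<in> verts" using that nbrs_subset unfolding verts_def by blast
      moreover have "f v \<noteq> f w" using f that by (simp add: colorings_def)
      ultimately show ?thesis
        using \<open>v \<in> verts\<close> by (simp add: inj_eq[OF inj_transpose])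
    qed
    ultimately show ?thesis unfolding colorings_def by blast
  qed
  have hh: "?h (?h f) = f" if "f \<in> colorings" for f
    using that by (auto simp: colorings_def PiE_iff extensional_def restrict_def fun_eq_iff)
  have "density i k (?h f) = density i j f" for i f
  proof -
    have "{v \<in> X i. ?h f v = k} = {v \<in> X i. f v = j}"
      using class_subset_verts[of i] by (auto simp: transpose_eq_iff)
    then show ?thesis by (simp add: density_def)
  qed
  then have "min_density k (?h f) = min_density j f" for f by (simp add: min_density_def)
  then show ?thesis
    by (intro sum.reindex_bij_witness[of _ ?h ?h]) (auto simp: h hh)
qed

lemma sum_min_density_single_ge:
  assumes k: "k \<in> {0, 1, 2}"
  shows "real (card colorings) \<le>
    (12 * (1 + real D ^ 2) + 48 * 3 ^ (D + 1)) * (\<Sum>f\<in>colorings. min_density k f)"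
proof -
  have "(\<Sum>f\<in>colorings. \<Sum>j\<in>{0, 1, 2}. min_density j f)
      = (\<Sum>j\<in>{0, 1, 2}. \<Sum>f\<in>colorings. min_density j f)"
    by (rule sum.swap)
  also have "\<dots> = (\<Sum>j\<in>{0::nat, 1, 2}. \<Sum>f\<in>colorings. min_density k f)"
    by (rule sum.cong[OF refl]) (rule sum_min_density_eq[OF _ k])
  also have "\<dots> = 3 * (\<Sum>f\<in>colorings. min_density k f)" by simp
  finally have eq: "(\<Sum>f\<in>colorings. \<Sum>j\<in>{0, 1, 2}. min_density j f)
      = 3 * (\<Sum>f\<in>colorings. min_density k f)" .
  show ?thesis
    using sum_min_density_ge unfolding eq by (simp add: algebra_simps)
qed

end

section \<open>The discrete torus as an instance\<close>

lemma torus_adj_sym: "torus_adj n d v w \<Longrightarrow> torus_adj n d w v"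
proof -
  assume "torus_adj n d v w"
  moreover have "[int (w i) - int (v i) = c] (mod int n) \<longleftrightarrow> [int (v i) - int (w i) = - c] (mod int n)" for i c
    using cong_minus_minus_iff[of "int (w i) - int (v i)" c "int n"] by simp
  ultimately show ?thesis
    unfolding torus_adj_def by fastforce
qed

text \<open>Coordinates are canonical residues, so a coordinate of a neighbor is determined by the
  direction of the step.\<close>

lemma cong_diff_imp_eq_mod:
  assumes "[int a - int b = c] (mod int n)" "b < n"
  shows "b = nat ((int a - c) mod int n)"
proof -
  have "[int b = int a - c] (mod int n)"
    using assms(1) by (simp add: cong_iff_dvd_diff dvd_diff_commute algebra_simps)
  then show ?thesis using assms(2) by (simp add: cong_def)
qed

lemma card_torus_nbrs: "card {w. torus_adj n d v w} \<le> 2 * d"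
proof -
  let ?step = "\<lambda>(i, c). v(i := nat ((int (v i) - c) mod int n))"
  have "{w. torus_adj n d v w} \<subseteq> ?step ` ({..<d} \<times> {1, - 1})"
  proof
    fix w assume "w \<in> {w. torus_adj n d v w}"
    then obtain i c where i: "i < d" and c: "c \<in> {1, - 1}" "[int (v i) - int (w i) = c] (mod int n)"
      and eq: "\<forall>j<d. j \<noteq> i \<longrightarrow> v j = w j"
      and vw: "v \<in> torus_verts n d" "w \<in> torus_verts n d"
      unfolding torus_adj_def by blast
    have "w i < n" using vw(2) i by (auto simp: torus_verts_def)
    then have wi: "w i = nat ((int (v i) - c) mod int n)"
      by (rule cong_diff_imp_eq_mod[OF c(2)])
    have "w j = (v(i := nat ((int (v i) - c) mod int n))) j" for j
    proof (cases "j < d")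
      case False
      then show ?thesis using vw i by (auto simp: torus_verts_def PiE_iff extensional_def)
    qed (use eq wi in auto)
    then have "w = ?step (i, c)" by auto
    then show "w \<in> ?step ` ({..<d} \<times> {1, - 1})" using i c(1) by blast
  qed
  then have "card {w. torus_adj n d v w} \<le> card (?step ` ({..<d} \<times> {1, - 1 :: int}))"
    by (rule card_mono[rotated]) auto
  also have "\<dots> \<le> card ({..<d} \<times> {1, - 1 :: int})" by (rule card_image_le) auto
  finally show ?thesis by (simp add: card_cartesian_product)
qed

text \<open>For even \<open>n\<close> the reflection \<open>x \<mapsto> n - 1 - x\<close> of one coordinate exchanges the two classes.\<close>

lemma card_partite_class_eq:
  assumes "even n" "d > 0"
  shows "card (partite_class n d 0) = card (partite_class n d 1)"
proof (rule bij_betw_same_card)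
  let ?r = "\<lambda>v :: nat \<Rightarrow> nat. v(0 := n - 1 - v 0)"
  have "?r v \<in> partite_class n d (1 - i) \<and> ?r (?r v) = v"
    if v: "v \<in> partite_class n d i" and i: "i \<in> {0, 1}" for v i
  proof -
    have v0: "v 0 < n" and tv: "v \<in> torus_verts n d"
      using v \<open>d > 0\<close> by (auto simp: partite_class_def torus_verts_def)
    have "?r v \<in> torus_verts n d"
      using tv v0 \<open>d > 0\<close> by (auto simp: torus_verts_def PiE_iff extensional_def)
    moreover have split: "(\<Sum>j<d. u j) = u 0 + (\<Sum>j\<in>{..<d} - {0}. u j)" for u :: "nat \<Rightarrow> nat"
      using \<open>d > 0\<close> by (intro sum.remove) auto
    have "(\<Sum>j\<in>{..<d} - {0}. (?r v) j) = (\<Sum>j\<in>{..<d} - {0}. v j)"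
      by (rule sum.cong) auto
    \<comment> \<open>Moving \<open>v 0\<close> to the left avoids truncated subtraction. As
      \<open>n\<close> is even, the summand 1 flips the parity.\<close>
    then have total: "(\<Sum>j<d. (?r v) j) + v 0 + 1 + v 0 = n + (\<Sum>j<d. v j)"
      using v0 split[of v] split[of "?r v"] by simp
    have "even (\<Sum>j<d. (?r v) j) \<longleftrightarrow> odd (\<Sum>j<d. v j)"
    proof -
      have "even x \<longleftrightarrow> odd y" if "x + z + 1 + z = n + y" for x y z :: nat
        using that \<open>even n\<close> by presburger
      then show ?thesis using total .
    qed
    ultimately show ?thesis
      using v i v0 by (auto simp: partite_class_def even_iff_mod_2_eq_zero fun_eq_iff)
  qed
  then show "bij_betw ?r (partite_class n d 0) (partite_class n d 1)"
    by (intro bij_betw_byWitness[where f' = ?r]) force+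
qed

lemma card_partite_class:
  assumes "even n" "d > 0"
  shows "2 * card (partite_class n d 0) = n ^ d"
proof -
  have "card (partite_class n d 0 \<union> partite_class n d 1)
      = card (partite_class n d 0) + card (partite_class n d 1)"
    by (rule card_Un_disjoint)
      (auto simp: partite_class_def intro: finite_subset[OF _ finite_torus_verts])
  then show ?thesis
    using card_partite_class_eq[OF assms]
    by (simp add: partite_class_Un torus_verts_def card_PiE del: One_nat_def)
qed

lemma torus_balanced_bipartite_graph:
  assumes "even n" "n > 0" "d \<ge> 8"
  shows "balanced_bipartite_graph (\<lambda>i. partite_class n d (of_bool i)) (\<lambda>v. {w. torus_adj n d v w})
           (n ^ d div 2) (2 * d)"
proof
  fix i :: bool and v w :: "nat \<Rightarrow> nat"
  have "d > 0" using assms by simp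
  show "finite (partite_class n d (of_bool i))"
    by (rule finite_subset[OF _ finite_torus_verts]) (auto simp: partite_class_def)
  show "card (partite_class n d (of_bool i)) = n ^ d div 2"
    using card_partite_class[OF assms(1) \<open>d > 0\<close>] card_partite_class_eq[OF assms(1) \<open>d > 0\<close>]
    by (cases i) auto
  show "partite_class n d (of_bool i) \<inter> partite_class n d (of_bool (\<not> i)) = {}"
    by (cases i) (auto simp: partite_class_def)
  show "{w. torus_adj n d v w} \<subseteq> partite_class n d (of_bool (\<not> i))"
    if "v \<in> partite_class n d (of_bool i)"
  proof
    fix w assume "w \<in> {w. torus_adj n d v w}"
    then have w: "w \<in> torus_verts n d" "(\<Sum>j<d. v j) mod 2 \<noteq> (\<Sum>j<d. w j) mod 2"
      using torus_adj_parity[OF assms(1)] by (auto simp: torus_adj_def)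
    with that show "w \<in> partite_class n d (of_bool (\<not> i))"
      by (cases i) (auto simp: partite_class_def)
  qed
  show "v \<in> {w'. torus_adj n d w w'}" if "w \<in> {w. torus_adj n d v w}"
    using that torus_adj_sym by simp
  show "card {w. torus_adj n d v w} \<le> 2 * d" by (rule card_torus_nbrs)
  show "2 * d > 0" using assms by simp
  \<comment> \<open>Both sides equal 256 at \<open>d = 8\<close>, which explains the threshold 8 for
    the dimension.\<close>
  have "32 * d \<le> 2 ^ d"
    using \<open>d \<ge> 8\<close> by (induction rule: dec_induct) auto
  also have "(2::nat) ^ d \<le> n ^ d"
    using assms by (intro power_mono) (auto elim: evenE)
  finally show "8 * (2 * d) \<le> n ^ d div 2" by simp
qed

section \<open>Numerical estimates and the expectation\<close>

text \<open>This absorbs the quadratic term of the counting constant into its exponential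
  term.\<close>

lemma square_le_two_times_three_power: "1 + m ^ 2 \<le> 2 * (3::nat) ^ m"
proof (induction m)
  case (Suc m)
  have "1 + (Suc m) ^ 2 \<le> 3 * (1 + m ^ 2)"
    by (cases m) (auto simp: power2_eq_square)
  with Suc show ?case by simp
qed simp

theorem proposition1p3:
  "\<exists>(d\<^sub>0::nat) (c::real). c > 0 \<and>
     (\<forall>(d::nat) (n::nat). d \<ge> d\<^sub>0 \<longrightarrow> n > 0 \<longrightarrow> even n \<longrightarrow>
        (\<forall>k\<in>{0, 1, 2}.
           measure_pmf.expectation (pmf_of_set (proper_3_colorings n d))
             (\<lambda>f. MIN i\<in>{0, 1}. color_proportion n d i k f) \<ge> exp (- c * real d)))"
proof (intro exI[of _ "8::nat"] exI[of _ "14::real"] conjI allI impI ballI)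
  fix d n k :: nat
  assume d: "8 \<le> d" and n: "0 < n" "even n" and k: "k \<in> {0, 1, 2}"
  interpret balanced_bipartite_graph "\<lambda>i. partite_class n d (of_bool i)"
    "\<lambda>v. {w. torus_adj n d v w}" "n ^ d div 2" "2 * d"
    by (rule torus_balanced_bipartite_graph[OF n(2,1) d])
  have "verts = torus_verts n d"
    by (auto simp: verts_def UNIV_bool partite_class_Un simp flip: One_nat_def)
  then have colorings: "colorings = proper_3_colorings n d"
    unfolding colorings_def proper_3_colorings_def by (auto simp: torus_adj_def)
  have min: "(MIN i\<in>{0, 1}. color_proportion n d i k f) = min_density k f" for f
    using card_class[of False] card_class[of True]
    by (simp add: color_proportion_def min_density_def density_def)
  define Z where "Z = 12 * (1 + real (2 * d) ^ 2) + 48 * 3 ^ (2 * d + 1)"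
  have "Z > 0" by (simp add: Z_def add_pos_pos add_pos_nonneg)
  have "1 + real (2 * d) ^ 2 \<le> 2 * 3 ^ (2 * d)"
    using of_nat_mono[OF square_le_two_times_three_power[of "2 * d"], where 'a = real] by simp
  \<comment> \<open>Here 168 = 12 * 2 + 48 * 3, which is below \<open>3 ^ 5\<close>. Bounding 3 by
    \<open>exp 2\<close> leaves the exponent \<open>10 + 4 * d\<close>, at most
    \<open>14 * d\<close>; this gives the constant 14.\<close>
  then have "Z \<le> 168 * 3 ^ (2 * d)" by (simp add: Z_def)
  also have "\<dots> \<le> 3 ^ 5 * 3 ^ (2 * d)" by simp
  also have "\<dots> = 3 ^ (5 + 2 * d)" by (simp add: power_add)
  also have "\<dots> \<le> exp (2::real) ^ (5 + 2 * d)"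
    using exp_ge_add_one_self[of 2] by (intro power_mono) auto
  also have "\<dots> = exp (real (5 + 2 * d) * 2)"
    by (simp only: exp_of_nat_mult)
  also have "\<dots> \<le> exp (14 * real d)" using d by simp
  finally have "exp (- 14 * real d) \<le> 1 / Z"
    using \<open>Z > 0\<close> by (simp add: exp_minus divide_simps)
  also have "\<dots> \<le> (\<Sum>f\<in>colorings. min_density k f) / real (card colorings)"
  proof -
    have "card colorings > 0"
      using finite_colorings proper_3_colorings_nonempty[OF n(2)] colorings by (simp add: card_gt_0_iff)
    with sum_min_density_single_ge[OF k] \<open>Z > 0\<close> show ?thesis
      unfolding Z_def[symmetric] by (simp add: divide_simps mult.commute)
  qed
  also have "\<dots> = measure_pmf.expectation (pmf_of_set (proper_3_colorings n d))
             (\<lambda>f. MIN i\<in>{0, 1}. color_proportion n d i k f)"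
    unfolding min colorings
    by (rule integral_pmf_of_set[symmetric])
      (auto simp: finite_proper_3_colorings proper_3_colorings_nonempty n)
  finally show "exp (- 14 * real d) \<le> measure_pmf.expectation (pmf_of_set (proper_3_colorings n d))
             (\<lambda>f. MIN i\<in>{0, 1}. color_proportion n d i k f)" .
qed simp

end
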